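(* For every positive integer $k$, let $\langle k\rangle$ denote the generalized pattern $k(k-1)\cdots21$ (no dashes). Then $$F_{\langle k\rangle}(x)=\sum_{j=0}^{k-1}\bigl(xF_{\langle k\rangle}(x)\bigr)^j.$$
   Context: A generalized pattern is a permutation of $\{1,\dots,k\}$ written as a word $\tau_1\cdots\tau_k$ in which each pair of adjacent letters may or may not be separated by a dash "-". A permutation $\pi=\pi_1\cdots\pi_n\in S_n$ contains $\tau$ if there are indices $i_1<\dots<i_k$ with $(\pi_{i_1},\dots,\pi_{i_k})$ order-isomorphic to $(\tau_1,\dots,\tau_k)$ and $i_{j+1}=i_j+1$ whenever $\tau_j,\tau_{j+1}$ are not separated by a dash; otherwise $\pi$ avoids $\tau$. Thus $k\cdots21$ (no dashes) requires $k$ consecutive decreasing entries, and $1\mbox{-}3\mbox{-}2$ is the classical pattern $132$. $F_\tau(x)=\sum_{n\geq0}f_\tau(n)x^n$, where $f_\tau(n)$ is the number of permutations in $S_n$ ($S_0$ = the empty permutation) avoiding both $1\mbox{-}3\mbox{-}2$ and $\tau$. *)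

theory Defs
  imports "HOL-Combinatorics.Multiset_Permutations" "HOL-Computational_Algebra.Formal_Power_Series"
begin

(* A generalized pattern is a word together with its set of dashes.  List positions count from 0:
   j is in the dash set iff a dash separates the letters at positions j and Suc j. *)
type_synonym gpattern = "nat list \<times> nat set"

definition is_gpattern :: "gpattern \<Rightarrow> bool" where
  "is_gpattern \<tau> \<longleftrightarrow>
     fst \<tau> \<in> permutations_of_set {1..length (fst \<tau>)} \<and> (\<forall>j\<in>snd \<tau>. Suc j < length (fst \<tau>))"

definition contains :: "nat list \<Rightarrow> gpattern \<Rightarrow> bool" where
  "contains \<pi> \<tau> \<longleftrightarrow>
     (let t = fst \<tau>; k = length t in
      \<exists>i. strict_mono_on {..<k} i \<and> (\<forall>a<k. i a < length \<pi>) \<and>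
          (\<forall>a<k. \<forall>b<k. \<pi> ! i a < \<pi> ! i b \<longleftrightarrow> t ! a < t ! b) \<and>
          (\<forall>j. Suc j < k \<and> j \<notin> snd \<tau> \<longrightarrow> i (Suc j) = i j + 1))"

definition avoids :: "nat list \<Rightarrow> gpattern \<Rightarrow> bool" where
  "avoids \<pi> \<tau> \<longleftrightarrow> \<not> contains \<pi> \<tau>"

definition pattern_1_3_2 :: gpattern where
  "pattern_1_3_2 = ([1, 3, 2], {0, 1})"

definition decreasing_pattern :: "nat \<Rightarrow> gpattern" where
  "decreasing_pattern k = (rev [1..<Suc k], {})"

definition f_count :: "gpattern \<Rightarrow> nat \<Rightarrow> nat" where
  "f_count \<tau> n =
     card {\<pi> \<in> permutations_of_set {1..n}. avoids \<pi> pattern_1_3_2 \<and> avoids \<pi> \<tau>}"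

definition F_gf :: "gpattern \<Rightarrow> int fps" where
  "F_gf \<tau> = Abs_fps (\<lambda>n. int (f_count \<tau> n))"

lemma is_gpattern_pattern_1_3_2: "is_gpattern pattern_1_3_2"
  by (auto simp: is_gpattern_def pattern_1_3_2_def permutations_of_set_def)

lemma is_gpattern_decreasing_pattern: "is_gpattern (decreasing_pattern k)"
  by (auto simp: is_gpattern_def decreasing_pattern_def permutations_of_set_def)

end

theory Submission
  imports Defs
begin

text \<open>
  Write a nonempty 1-3-2-avoiding permutation as \<open>\<sigma> n \<tau>\<close> with \<open>n\<close> its maximum; then every letter
  of \<open>\<sigma>\<close> exceeds every letter of \<open>\<tau>\<close>. Let \<open>G m\<close> be the generating function of the permutations
  avoiding 1-3-2 and \<open>k\<dots>21\<close> whose initial decreasing run has length at most \<open>m\<close>. The initial run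
  of \<open>\<sigma> n \<tau>\<close> is that of \<open>\<sigma>\<close> if \<open>\<sigma>\<close> is nonempty, and otherwise \<open>n\<close> followed by that of \<open>\<tau>\<close>, so
  \<open>G m = 1 + x G (m - 1) + x (G m - 1) G (k - 2)\<close> for \<open>1 \<le> m < k\<close>. As \<open>F = G (k - 1)\<close>, the case
  \<open>m = k - 1\<close> says \<open>F (1 - x G (k - 2)) = 1\<close>. Multiplying the general equation by \<open>F\<close> gives
  \<open>G m = 1 + x F G (m - 1)\<close>, hence \<open>G m\<close> is the sum of \<open>(x F) ^ j\<close> over \<open>j \<le> m\<close>.
\<close>

section \<open>Recursive list forms of the two avoidance conditions\<close>

fun avoids_132 :: "nat list \<Rightarrow> bool" where
  "avoids_132 [] = True"
| "avoids_132 (x # xs) = (sorted_wrt (\<lambda>b c. \<not> (x < c \<and> c < b)) xs \<and> avoids_132 xs)"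

fun decreasing_run :: "nat list \<Rightarrow> nat" where
  "decreasing_run [] = 0"
| "decreasing_run [x] = 1"
| "decreasing_run (x # y # zs) = (if y < x then Suc (decreasing_run (y # zs)) else 1)"

text \<open>Every block of consecutive decreasing letters starts some suffix, so bounding the
  initial run of each suffix bounds all such blocks.\<close>

fun decreasing_runs_below :: "nat \<Rightarrow> nat list \<Rightarrow> bool" where
  "decreasing_runs_below k [] = True"
| "decreasing_runs_below k (x # xs) = (decreasing_run (x # xs) < k \<and> decreasing_runs_below k xs)"

lemma avoids_132_iff_nth:
  "avoids_132 xs \<longleftrightarrow>
     (\<forall>a b c. a < b \<and> b < c \<and> c < length xs \<longrightarrow> \<not> (xs ! a < xs ! c \<and> xs ! c < xs ! b))"
proof (induction xs)
  case Nil
  then show ?case by simp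
next
  case (Cons x xs)
  show ?case (is "_ \<longleftrightarrow> (\<forall>a b c. ?P a b c)")
  proof
    assume *: "avoids_132 (x # xs)"
    show "\<forall>a b c. ?P a b c"
    proof (intro allI impI)
      fix a b c assume abc: "a < b \<and> b < c \<and> c < length (x # xs)"
      then obtain b' c' where bc: "b = Suc b'" "c = Suc c'"
        by (cases b; cases c) auto
      show "\<not> ((x # xs) ! a < (x # xs) ! c \<and> (x # xs) ! c < (x # xs) ! b)"
        using * abc Cons.IH bc by (cases a) (auto simp: sorted_wrt_iff_nth_less)
    qed
  next
    assume *: "\<forall>a b c. ?P a b c"
    \<comment> \<open>Either the head plays the 1 or all three positions lie in the tail: the two
      conjuncts of the recursion.\<close>
    have "?P 0 (Suc b) (Suc c)" "?P (Suc a) (Suc b) (Suc c)" for a b c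
      using * by blast+
    then show "avoids_132 (x # xs)"
      using Cons.IH by (auto simp: sorted_wrt_iff_nth_less)
  qed
qed

lemma avoids_pattern_1_3_2_iff: "avoids xs pattern_1_3_2 \<longleftrightarrow> avoids_132 xs"
proof -
  have "contains xs pattern_1_3_2 \<longleftrightarrow>
      (\<exists>a b c. a < b \<and> b < c \<and> c < length xs \<and> xs ! a < xs ! c \<and> xs ! c < xs ! b)"
    (is "?L \<longleftrightarrow> ?R")
  proof
    assume ?L
    then obtain i where i: "strict_mono_on {..<3::nat} i" "\<forall>a<3. i a < length xs"
      "\<forall>a<3. \<forall>b<3. xs ! i a < xs ! i b \<longleftrightarrow> [1,3,2::nat] ! a < [1,3,2] ! b"
      by (auto simp: contains_def pattern_1_3_2_def Let_def numeral_3_eq_3)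
    have "i 0 < i 1" "i 1 < i 2" "i 2 < length xs"
      using i(1,2) by (auto simp: strict_mono_on_def)
    moreover have "xs ! i 0 < xs ! i 2" "xs ! i 2 < xs ! i 1"
      using i(3) by auto
    ultimately show ?R by blast
  next
    assume ?R
    then obtain a b c where abc: "a < b" "b < c" "c < length xs" "xs ! a < xs ! c" "xs ! c < xs ! b"
      by blast
    \<comment> \<open>The index map is tabulated by a list. Both gaps of the pattern carry dashes,
      so no adjacency condition arises.\<close>
    have "strict_mono_on {..<3::nat} (\<lambda>j. [a,b,c] ! j)"
      using abc by (auto simp: strict_mono_on_def less_Suc_eq numeral_3_eq_3)
    then show ?L
      using abc unfolding contains_def pattern_1_3_2_def Let_def
      by (intro exI[of _ "\<lambda>j. [a,b,c] ! j"]) (auto simp: less_Suc_eq numeral_3_eq_3)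
  qed
  then show ?thesis
    unfolding avoids_def avoids_132_iff_nth by blast
qed

lemma le_decreasing_run_iff:
  "k \<le> decreasing_run xs \<longleftrightarrow> k \<le> length xs \<and> sorted_wrt (>) (take k xs)"
proof (induction xs arbitrary: k rule: decreasing_run.induct)
  case (3 x y zs)
  \<comment> \<open>Transitivity reduces \<open>sorted_wrt (>)\<close> to comparisons of neighbours,
    which are all that \<open>decreasing_run\<close> examines.\<close>
  have trans: "transp ((>) :: nat \<Rightarrow> nat \<Rightarrow> bool)"
    by (auto intro: transpI)
  show ?case
  proof (cases k)
    case (Suc k')
    then show ?thesis
      using 3 by (cases k') (auto simp: sorted_wrt2[OF trans] sorted_wrt1 simp del: sorted_wrt.simps(2))
  qed simp
qed (auto simp: le_Suc_eq)

lemma decreasing_runs_below_iff_drop: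
  "decreasing_runs_below k xs \<longleftrightarrow> (\<forall>p<length xs. decreasing_run (drop p xs) < k)"
  by (induction xs) (auto simp: All_less_Suc2)

text \<open>Without dashes the first index of an occurrence determines the others, so an occurrence
  is a decreasing block of \<open>k\<close> consecutive positions. For \<open>k = 0\<close> the
  empty list would be an exception: it contains the empty pattern but has no position
  \<open>p\<close>.\<close>

lemma contains_decreasing_pattern_iff:
  assumes "k \<ge> 1"
  shows "contains xs (decreasing_pattern k) \<longleftrightarrow> (\<exists>p<length xs. k \<le> decreasing_run (drop p xs))"
proof -
  have len: "length (rev [1..<Suc k]) = k"
    by simp
  have nth: "rev [1..<Suc k] ! a = k - a" if "a < k" for a
    using that by (simp add: rev_nth del: upt_Suc)
  have iff: "k \<le> decreasing_run (drop p xs) \<longleftrightarrow>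
      p + k \<le> length xs \<and> (\<forall>a<k. \<forall>b<k. xs ! (p + a) < xs ! (p + b) \<longleftrightarrow> b < a)"
    if "p < length xs" for p
  proof -
    have "k \<le> decreasing_run (drop p xs) \<longleftrightarrow>
        p + k \<le> length xs \<and> (\<forall>a b. a < b \<and> b < k \<longrightarrow> xs ! (p + b) < xs ! (p + a))"
      using that by (auto simp: le_decreasing_run_iff sorted_wrt_iff_nth_less)
    moreover have "(\<forall>a b. a < b \<and> b < k \<longrightarrow> xs ! (p + b) < xs ! (p + a)) \<longleftrightarrow>
        (\<forall>a<k. \<forall>b<k. xs ! (p + a) < xs ! (p + b) \<longleftrightarrow> b < a)" (is "?P \<longleftrightarrow> ?Q")
    proof (rule iffI)
      show ?Q if ?P
      proof (intro allI impI)
        fix a b assume "a < k" "b < k"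
        then have "a < b \<Longrightarrow> xs ! (p + b) < xs ! (p + a)" "b < a \<Longrightarrow> xs ! (p + a) < xs ! (p + b)"
          using that by blast+
        then show "xs ! (p + a) < xs ! (p + b) \<longleftrightarrow> b < a"
          by (cases a b rule: linorder_cases) auto
      qed
    qed auto
    ultimately show ?thesis by simp
  qed
  show ?thesis (is "?L \<longleftrightarrow> ?R")
  proof
    assume ?L
    then obtain i where i: "\<forall>a<k. i a < length xs"
      "\<forall>a<k. \<forall>b<k. xs ! i a < xs ! i b \<longleftrightarrow> rev [1..<Suc k] ! a < rev [1..<Suc k] ! b"
      "\<forall>j. Suc j < k \<longrightarrow> i (Suc j) = i j + 1"
      unfolding contains_def decreasing_pattern_def Let_def fst_conv snd_conv len by auto
    have step: "a < k \<Longrightarrow> i a = i 0 + a" for a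
      by (induction a) (use i(3) in auto)
    have "i 0 + k \<le> length xs"
      using i(1)[rule_format, of "k - 1"] step[of "k - 1"] assms by simp
    moreover have "\<forall>a<k. \<forall>b<k. xs ! (i 0 + a) < xs ! (i 0 + b) \<longleftrightarrow> b < a"
    proof (intro allI impI)
      fix a b assume ab: "a < k" "b < k"
      have "xs ! i a < xs ! i b \<longleftrightarrow> k - a < k - b"
        using i(2) ab nth by metis
      then show "xs ! (i 0 + a) < xs ! (i 0 + b) \<longleftrightarrow> b < a"
        using ab unfolding step[OF ab(1)] step[OF ab(2)] by auto
    qed
    moreover have "i 0 < length xs"
      using i(1) assms by simp
    ultimately show ?R
      using iff by blast
  next
    assume ?R
    then obtain p where p: "p + k \<le> length xs"
      "\<forall>a<k. \<forall>b<k. xs ! (p + a) < xs ! (p + b) \<longleftrightarrow> b < a"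
      using iff by blast
    then show ?L
      unfolding contains_def decreasing_pattern_def Let_def fst_conv snd_conv len
      by (intro exI[of _ "\<lambda>a. p + a"]) (auto simp: strict_mono_on_def nth simp del: upt_Suc One_nat_def)
  qed
qed

lemma avoids_decreasing_pattern_iff:
  "k \<ge> 1 \<Longrightarrow> avoids xs (decreasing_pattern k) \<longleftrightarrow> decreasing_runs_below k xs"
  unfolding avoids_def contains_decreasing_pattern_iff decreasing_runs_below_iff_drop
  by (meson not_le)

section \<open>Splitting a list at its maximum\<close>

text \<open>The maximum \<open>n\<close> can only play the 3, and \<open>x\<close>,
  \<open>n\<close>, \<open>y\<close> form an occurrence exactly when \<open>x < y\<close>. If no
  such pair exists, an occurrence cannot start in \<open>s\<close> and end in \<open>t\<close>, so
  it lies within one part. Letters may repeat here, hence the weak inequality.\<close>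

lemma avoids_132_append_max:
  assumes "\<forall>x\<in>set s. x < n" "\<forall>x\<in>set t. x < n"
  shows "avoids_132 (s @ n # t) \<longleftrightarrow>
           avoids_132 s \<and> avoids_132 t \<and> (\<forall>x\<in>set s. \<forall>y\<in>set t. y \<le> x)"
  using assms
proof (induction s)
  case Nil
  then have "sorted_wrt (\<lambda>b c. \<not> (n < c \<and> c < b)) t"
    by (auto simp: sorted_wrt_iff_nth_less dest!: nth_mem)
  then show ?case by simp
next
  case (Cons x s)
  have "sorted_wrt (\<lambda>b c. \<not> (x < c \<and> c < b)) t" if "\<forall>y\<in>set t. y \<le> x"
    using that by (auto simp: sorted_wrt_iff_nth_less not_less)
  then have "sorted_wrt (\<lambda>b c. \<not> (x < c \<and> c < b)) (s @ n # t) \<longleftrightarrow>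
      sorted_wrt (\<lambda>b c. \<not> (x < c \<and> c < b)) s \<and> (\<forall>y\<in>set t. y \<le> x)"
    using Cons.prems by (fastforce simp: sorted_wrt_append not_less)
  then show ?case
    using Cons by auto
qed

lemma decreasing_run_Cons_max:
  "\<forall>x\<in>set t. x < n \<Longrightarrow> decreasing_run (n # t) = Suc (decreasing_run t)"
  by (cases t) auto

text \<open>The ascent to \<open>n\<close> stops a run that reaches the end of
  \<open>s\<close>.\<close>

lemma decreasing_run_append_max:
  "s \<noteq> [] \<Longrightarrow> \<forall>x\<in>set s. x < n \<Longrightarrow> decreasing_run (s @ n # t) = decreasing_run s"
  by (induction s rule: decreasing_run.induct) auto

lemma decreasing_runs_below_append_max:
  assumes "\<forall>x\<in>set s. x < n"
  shows "decreasing_runs_below k (s @ n # t) \<longleftrightarrow>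
           decreasing_runs_below k s \<and> decreasing_runs_below k (n # t)"
  using assms
proof (induction s)
  case (Cons x s)
  have "decreasing_run (x # s @ n # t) = decreasing_run (x # s)"
    using decreasing_run_append_max[of "x # s" n t] Cons.prems by simp
  then show ?case
    using Cons by auto
qed simp

section \<open>Invariance under adding a constant to all letters\<close>

lemma decreasing_run_map_add: "decreasing_run (map ((+) c) xs) = decreasing_run xs"
  by (induction xs rule: decreasing_run.induct) auto

lemma decreasing_runs_below_map_add:
  "decreasing_runs_below k (map ((+) c) xs) \<longleftrightarrow> decreasing_runs_below k xs"
proof (induction xs)
  case (Cons x xs)
  then show ?case
    using decreasing_run_map_add[of c "x # xs"] by simp
qed simp

lemma avoids_132_map_add: "avoids_132 (map ((+) c) xs) \<longleftrightarrow> avoids_132 xs"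
  by (induction xs) (auto simp: sorted_wrt_map)

section \<open>Permutations with bounded initial run and their decomposition\<close>

definition run_bounded_perms :: "nat \<Rightarrow> nat \<Rightarrow> nat \<Rightarrow> nat list set" where
  "run_bounded_perms k m n =
     {\<pi> \<in> permutations_of_set {1..n}.
        avoids_132 \<pi> \<and> decreasing_runs_below k \<pi> \<and> decreasing_run \<pi> \<le> m}"

text \<open>This is \<open>G m\<close> with \<open>k\<close> made explicit.\<close>

definition run_bounded_gf :: "nat \<Rightarrow> nat \<Rightarrow> int fps" where
  "run_bounded_gf k m = Abs_fps (\<lambda>n. int (card (run_bounded_perms k m n)))"

lemma finite_run_bounded_perms: "finite (run_bounded_perms k m n)"
  by (simp add: run_bounded_perms_def)

lemma run_bounded_perms_0: "run_bounded_perms k m 0 = {[]}"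
  by (auto simp: run_bounded_perms_def)

lemma length_run_bounded_perms: "\<pi> \<in> run_bounded_perms k m n \<Longrightarrow> length \<pi> = n"
  by (auto simp: run_bounded_perms_def length_finite_permutations_of_set)

lemma set_run_bounded_perms: "\<pi> \<in> run_bounded_perms k m n \<Longrightarrow> set \<pi> = {1..n}"
  by (auto simp: run_bounded_perms_def permutations_of_set_def)

text \<open>A number between 1 and \<open>Max T\<close> that lay in \<open>S\<close> would be at
  least \<open>Max T\<close>, hence equal to it, against disjointness. So \<open>T\<close> is an
  initial segment.\<close>

lemma lower_part_eq_interval:
  fixes S T :: "nat set"
  assumes "S \<union> T = {1..n}" "S \<inter> T = {}" "\<forall>x\<in>S. \<forall>y\<in>T. y \<le> x"
  shows "T = {1..card T}"
proof (cases "T = {}")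
  case False
  have fin: "finite T"
    using assms(1) by (metis finite_Un finite_atLeastAtMost)
  have "T = {1..Max T}"
  proof (intro equalityI subsetI)
    fix x assume "x \<in> T"
    then show "x \<in> {1..Max T}"
      using assms(1) fin by auto
  next
    fix x assume x: "x \<in> {1..Max T}"
    have M: "Max T \<in> T"
      using fin False by simp
    then have "Max T \<in> {1..n}"
      using assms(1) by blast
    then have "x \<in> S \<union> T"
      using x unfolding assms(1) by auto
    then show "x \<in> T"
      using x M assms(2,3) by (metis IntI UnE atLeastAtMost_iff empty_iff le_antisym)
  qed
  then show ?thesis
    by (metis card_atLeastAtMost diff_Suc_1 One_nat_def)
qed simp

text \<open>The position of the maximum alone fixes the letters on each side. This lets both parts
  be standardised and chosen independently.\<close>

lemma set_parts_around_max:
  assumes perm: "s @ Suc n # t \<in> permutations_of_set {1..Suc n}"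
    and av: "avoids_132 (s @ Suc n # t)"
  shows "set t = {1..length t}" "set s = {Suc (length t)..n}"
proof -
  have d: "distinct (s @ Suc n # t)" and set: "set (s @ Suc n # t) = {1..Suc n}"
    using perm by (auto simp: permutations_of_set_def)
  have "set s \<union> set t = set (s @ Suc n # t) - {Suc n}"
    using d by auto
  also have "\<dots> = {1..n}"
    unfolding set by auto
  finally have un: "set s \<union> set t = {1..n}" .
  then have "x < Suc n" if "x \<in> set s \<union> set t" for x
    using that by simp
  then have lt: "\<forall>x\<in>set s. x < Suc n" "\<forall>x\<in>set t. x < Suc n"
    by blast+
  show t: "set t = {1..length t}"
    using lower_part_eq_interval[OF un] d av avoids_132_append_max[OF lt] distinct_card[of t]
    by auto
  have "set s = {1..n} - {1..length t}"
    using un d t by auto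
  also have "\<dots> = {Suc (length t)..n}"
    by auto
  finally show "set s = {Suc (length t)..n}" .
qed

text \<open>Adding \<open>length t\<close> lifts the standardised \<open>s\<close> above
  \<open>t\<close>. The maximum lengthens the initial run of \<open>t\<close> by one and the result
  must stay below \<open>k\<close>, whence \<open>k - 2\<close>. If \<open>s\<close> is empty, this
  is also the initial run of the whole, whence the sharper \<open>m - 1\<close>. The bounds on
  \<open>m\<close> give \<open>k \<ge> 2\<close>, so neither subtraction truncates.\<close>

lemma append_max_mem_run_bounded_perms_iff:
  assumes "1 \<le> m" "m < k" "length s + length t = n"
  shows "map ((+) (length t)) s @ Suc n # t \<in> run_bounded_perms k m (Suc n) \<longleftrightarrow>
     t \<in> run_bounded_perms k (if s = [] then m - 1 else k - 2) (length t) \<and>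
     s \<in> run_bounded_perms k m (length s)" (is "?L \<longleftrightarrow> ?R")
proof -
  let ?s = "map ((+) (length t)) s"
  \<comment> \<open>The equivalence is proved first for standardised parts; each of its two sides
    forces the parts to be standardised.\<close>
  have main: "?L \<longleftrightarrow> ?R" if "set s = {1..length s}" "set t = {1..length t}"
  proof -
    have ds: "distinct s" "distinct t"
      using that by (auto intro: card_distinct)
    have lt: "\<forall>x\<in>set ?s. x < Suc n" "\<forall>x\<in>set t. x < Suc n"
      using that assms(3) by auto
    have "(+) (length t) ` {1..length s} = {Suc (length t)..n}"
      using assms(3) by (simp add: image_add_atLeastAtMost add.commute)
    then have "set (?s @ Suc n # t) = {1..Suc n}"
      using that assms(3) by auto
    moreover have "distinct (?s @ Suc n # t)"
      using that ds assms(3) by (auto simp: distinct_map)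
    ultimately have perm: "?s @ Suc n # t \<in> permutations_of_set {1..Suc n}"
      by (rule permutations_of_setI)
    have perms: "s \<in> permutations_of_set {1..length s}" "t \<in> permutations_of_set {1..length t}"
      using that ds by (auto intro: permutations_of_setI)
    have a: "avoids_132 (?s @ Suc n # t) \<longleftrightarrow> avoids_132 s \<and> avoids_132 t"
      using that by (simp add: avoids_132_append_max[OF lt] avoids_132_map_add)
    have b: "decreasing_runs_below k (?s @ Suc n # t) \<longleftrightarrow>
        decreasing_runs_below k s \<and> decreasing_run t \<le> k - 2 \<and> decreasing_runs_below k t"
      using assms(1,2)
      by (auto simp: decreasing_runs_below_append_max[OF lt(1)] decreasing_runs_below_map_add
          decreasing_run_Cons_max[OF lt(2)])
    have c: "decreasing_run (?s @ Suc n # t) =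
        (if s = [] then Suc (decreasing_run t) else decreasing_run s)"
      using decreasing_run_append_max[OF _ lt(1), of t] decreasing_run_Cons_max[OF lt(2)]
      by (auto simp: decreasing_run_map_add)
    show ?thesis
      using perm perms assms(1,2) by (auto simp: run_bounded_perms_def a b c)
  qed
  show ?thesis
  proof (cases ?L)
    case True
    then have *: "set t = {1..length t}" "set ?s = {Suc (length t)..n}"
      using set_parts_around_max[of ?s n t] by (simp_all add: run_bounded_perms_def)
    note *(2)
    also have "{Suc (length t)..n} = (+) (length t) ` {1..length s}"
      using assms(3) by (simp add: add.commute)
    finally have "set s = {1..length s}"
      by (simp add: inj_image_eq_iff del: image_add_atLeastAtMost)
    then show ?thesis
      using main * by simp
  next
    case False
    then show ?thesis
      using main set_run_bounded_perms by blast
  qed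
qed

section \<open>The counting recurrence\<close>

lemma card_run_bounded_perms_Suc:
  assumes "1 \<le> m" "m < k"
  shows "card (run_bounded_perms k m (Suc n)) =
     (\<Sum>i\<le>n. card (run_bounded_perms k m i) *
        card (run_bounded_perms k (if i = 0 then m - 1 else k - 2) (n - i)))"
proof -
  let ?A = "\<lambda>i. run_bounded_perms k m i \<times>
              run_bounded_perms k (if i = 0 then m - 1 else k - 2) (n - i)"
  \<comment> \<open>Here \<open>i\<close> counts the letters before the maximum, so the shift
    \<open>n - i\<close> is the length of \<open>t\<close>.\<close>
  let ?f = "\<lambda>(i, s, t). map ((+) (n - i)) s @ Suc n # t"
  have "bij_betw ?f (Sigma {..n} ?A) (run_bounded_perms k m (Suc n))"
  proof (rule bij_betw_imageI)
    show "inj_on ?f (Sigma {..n} ?A)"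
    proof (rule inj_onI)
      fix u v assume "u \<in> Sigma {..n} ?A" "v \<in> Sigma {..n} ?A" "?f u = ?f v"
      then obtain i s t i' s' t' where uv: "u = (i, s, t)" "v = (i', s', t')"
        and i: "i \<le> n" "i' \<le> n"
        and s: "s \<in> run_bounded_perms k m i" "s' \<in> run_bounded_perms k m i'"
        and t: "t \<in> run_bounded_perms k (if i = 0 then m - 1 else k - 2) (n - i)"
          "t' \<in> run_bounded_perms k (if i' = 0 then m - 1 else k - 2) (n - i')"
        and eq: "map ((+) (n - i)) s @ Suc n # t = map ((+) (n - i')) s' @ Suc n # t'"
        by auto
      \<comment> \<open>The maximum occurs in neither outer part, so the place of the split is
        unique.\<close>
      have "Suc n \<notin> set (map ((+) (n - i)) s)" "Suc n \<notin> set t"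
        using i s(1) t(1) by (auto simp: set_run_bounded_perms)
      then have *: "map ((+) (n - i)) s = map ((+) (n - i')) s'" "t = t'"
        using eq by (simp_all add: append_Cons_eq_iff)
      have "i = i'"
        using *(1) s length_run_bounded_perms by (metis length_map)
      then show "u = v"
        using * uv by (simp add: inj_map_eq_map)
    qed
    show "?f ` Sigma {..n} ?A = run_bounded_perms k m (Suc n)"
    proof (intro equalityI subsetI)
      fix \<pi> assume "\<pi> \<in> ?f ` Sigma {..n} ?A"
      then obtain i s t where i: "i \<le> n" and s: "s \<in> run_bounded_perms k m i"
        and t: "t \<in> run_bounded_perms k (if i = 0 then m - 1 else k - 2) (n - i)"
        and \<pi>: "\<pi> = map ((+) (n - i)) s @ Suc n # t"
        by auto
      have "length s = i" "length t = n - i"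
        using s t by (auto dest: length_run_bounded_perms)
      then show "\<pi> \<in> run_bounded_perms k m (Suc n)"
        using append_max_mem_run_bounded_perms_iff[OF assms, of s t n] i s t \<pi>
        by (auto split: if_splits)
    next
      fix \<pi> assume \<pi>: "\<pi> \<in> run_bounded_perms k m (Suc n)"
      then have perm: "\<pi> \<in> permutations_of_set {1..Suc n}" and av: "avoids_132 \<pi>"
        by (auto simp: run_bounded_perms_def)
      have "Suc n \<in> set \<pi>"
        using set_run_bounded_perms[OF \<pi>] by simp
      then obtain s' t where st: "\<pi> = s' @ Suc n # t"
        by (meson split_list)
      \<comment> \<open>This undoes the shift; natural subtraction loses nothing because the letters
        of \<open>s'\<close> are at least \<open>length t\<close>.\<close>
      define s where "s = map (\<lambda>x. x - length t) s'"
      have "length t \<le> x" if "x \<in> set s'" for x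
        using that set_parts_around_max(2)[of s' n t] perm av st by simp
      then have s': "s' = map ((+) (length t)) s"
        by (auto simp: s_def map_idI)
      have len: "length s + length t = n"
        using length_run_bounded_perms[OF \<pi>] st s' by simp
      have "s \<in> run_bounded_perms k m (length s)"
        "t \<in> run_bounded_perms k (if length s = 0 then m - 1 else k - 2) (n - length s)"
        using append_max_mem_run_bounded_perms_iff[OF assms len] \<pi> st s' len by auto
      moreover have "\<pi> = ?f (length s, s, t)"
        using st s' len by auto
      ultimately show "\<pi> \<in> ?f ` Sigma {..n} ?A"
        using len by (intro image_eqI[of _ _ "(length s, s, t)"]) auto
    qed
  qed
  then have "card (run_bounded_perms k m (Suc n)) = card (Sigma {..n} ?A)"
    by (simp add: bij_betw_same_card)
  also have "\<dots> = (\<Sum>i\<le>n. card (?A i))"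
    by (intro card_SigmaI) (auto simp: finite_run_bounded_perms)
  finally show ?thesis
    by (simp add: card_cartesian_product)
qed

section \<open>Generating functions\<close>

lemma run_bounded_gf_rec:
  assumes "1 \<le> m" "m < k"
  shows "run_bounded_gf k m =
     1 + fps_X * run_bounded_gf k (m - 1) +
     fps_X * ((run_bounded_gf k m - 1) * run_bounded_gf k (k - 2))"
    (is "?G m = _")
proof (rule fps_ext)
  fix N
  show "fps_nth (?G m) N =
    fps_nth (1 + fps_X * ?G (m - 1) + fps_X * ((?G m - 1) * ?G (k - 2))) N"
  proof (cases N)
    case 0
    then show ?thesis
      by (simp add: run_bounded_gf_def run_bounded_perms_0)
  next
    case (Suc n)
    let ?c = "\<lambda>m n. int (card (run_bounded_perms k m n))"
    have "fps_nth (?G m) (Suc n) =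
        (\<Sum>i\<le>n. ?c m i * ?c (if i = 0 then m - 1 else k - 2) (n - i))"
      by (simp add: run_bounded_gf_def card_run_bounded_perms_Suc[OF assms])
    also have "\<dots> = ?c (m - 1) n + (\<Sum>i\<in>{..n} - {0}. ?c m i * ?c (k - 2) (n - i))"
      by (subst sum.remove[of _ 0]) (auto simp: run_bounded_perms_0 intro!: sum.cong)
    \<comment> \<open>Subtracting 1 from \<open>?G m\<close> makes its constant coefficient zero, so
      the index 0 can be restored and the sum becomes a Cauchy product.\<close>
    also have "(\<Sum>i\<in>{..n} - {0}. ?c m i * ?c (k - 2) (n - i)) =
        (\<Sum>i\<le>n. fps_nth (?G m - 1) i * fps_nth (?G (k - 2)) (n - i))"
      by (subst (2) sum.remove[of _ 0])
        (auto simp: run_bounded_gf_def run_bounded_perms_0 intro!: sum.cong)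
    also have "\<dots> = fps_nth ((?G m - 1) * ?G (k - 2)) n"
      by (simp add: fps_mult_nth atLeast0AtMost)
    finally show ?thesis
      by (simp add: Suc run_bounded_gf_def)
  qed
qed

lemma decreasing_run_less:
  "k \<ge> 1 \<Longrightarrow> decreasing_runs_below k xs \<Longrightarrow> decreasing_run xs < k"
  by (cases xs) auto

text \<open>Once all runs are below \<open>k\<close>, the bound \<open>k - 1\<close> on the initial
  run holds automatically.\<close>

lemma F_gf_decreasing_pattern:
  assumes "k \<ge> 1"
  shows "F_gf (decreasing_pattern k) = run_bounded_gf k (k - 1)"
proof -
  have "f_count (decreasing_pattern k) n = card (run_bounded_perms k (k - 1) n)" for n
    unfolding f_count_def run_bounded_perms_def
    using assms decreasing_run_less[OF assms]
    by (intro arg_cong[where f = card])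
      (force simp: avoids_pattern_1_3_2_iff avoids_decreasing_pattern_iff)
  then show ?thesis
    by (simp add: F_gf_def run_bounded_gf_def)
qed

text \<open>A nonempty list has an initial run of at least one letter, so only the empty permutation
  is counted.\<close>

lemma run_bounded_gf_0: "run_bounded_gf k 0 = 1"
proof -
  have "run_bounded_perms k 0 n = {}" if "n > 0" for n
  proof -
    have pos: "decreasing_run \<pi> > 0" if "\<pi> \<noteq> []" for \<pi>
      using that by (induction \<pi> rule: decreasing_run.induct) auto
    have "\<pi> \<notin> run_bounded_perms k 0 n" for \<pi>
    proof
      assume \<pi>: "\<pi> \<in> run_bounded_perms k 0 n"
      then have "\<pi> \<noteq> []"
        using length_run_bounded_perms[OF \<pi>] that by auto
      then show False
        using pos[of \<pi>] \<pi> by (simp add: run_bounded_perms_def)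
    qed
    then show ?thesis
      by blast
  qed
  then show ?thesis
    by (intro fps_ext) (auto simp: run_bounded_gf_def run_bounded_perms_0)
qed

lemma run_bounded_gf_eq_sum:
  assumes "m < k"
  shows "run_bounded_gf k m = (\<Sum>j=0..m. (fps_X * run_bounded_gf k (k - 1)) ^ j)"
  using assms
proof (induction m)
  case 0
  then show ?case by (simp add: run_bounded_gf_0)
next
  case (Suc m)
  let ?F = "run_bounded_gf k (k - 1)" and ?G = "run_bounded_gf k"
  \<comment> \<open>\<open>Suc m < k\<close> forces \<open>k \<ge> 2\<close>, so the recurrence also
    applies at \<open>k - 1\<close>. For \<open>k = 1\<close> only the base case occurs.\<close>
  have k: "1 \<le> k - 1" "k - 1 < k" "k - 1 - 1 = k - 2"
    using Suc.prems by auto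
  \<comment> \<open>At \<open>k - 1\<close> the terms \<open>fps_X * ?G (k - 2)\<close> cancel,
    which makes \<open>?F\<close> the inverse of \<open>1 - fps_X * ?G (k - 2)\<close>.\<close>
  have F: "?F = 1 + fps_X * (?F * ?G (k - 2))"
    using run_bounded_gf_rec[OF k(1,2)] unfolding k(3) by (simp add: algebra_simps)
  have "?G (Suc m) = 1 + fps_X * ?G m + fps_X * ((?G (Suc m) - 1) * ?G (k - 2))"
    using run_bounded_gf_rec[of "Suc m" k] Suc.prems by simp
  \<comment> \<open>Collecting \<open>?G (Suc m)\<close> on the left gives it the factor
    \<open>1 - fps_X * ?G (k - 2)\<close>, which multiplication by \<open>?F\<close>
    removes.\<close>
  then have "?G (Suc m) = 1 + fps_X * ?F * ?G m"
    using F by algebra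
  also have "\<dots> = 1 + (\<Sum>j=0..m. (fps_X * ?F) ^ Suc j)"
    using Suc by (simp add: sum_distrib_left)
  also have "\<dots> = (\<Sum>j=0..Suc m. (fps_X * ?F) ^ j)"
    by (subst sum.atLeast0_atMost_Suc_shift) simp
  finally show ?case .
qed

theorem theorem2p12:
  fixes k :: nat
  assumes "k \<ge> 1"
  shows "F_gf (decreasing_pattern k) =
           (\<Sum>j=0..k-1. (fps_X * F_gf (decreasing_pattern k)) ^ j)"
  unfolding F_gf_decreasing_pattern[OF assms]
  by (rule run_bounded_gf_eq_sum) (use assms in simp)

end
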